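(* For any Dedekind cut $(A|B)$, we have $\sup A\sim\inf B$, where $\sup A$ and $\inf B$ are taken in $(\mathcal R,\preceq)$.
   Context: $\mathbb N=\{1,2,3,\dots\}$ and $\mathcal Z_{10}=\{0,1,\dots,9\}$. $\mathcal R$ is the set of all formal decimals $x=x_0.x_1x_2x_3\cdots$ with $x_0\in\mathbb Z$ and $x_k\in\mathcal Z_{10}$ for $k\in\mathbb N$; two elements are equal iff all their digits agree. For $k\in\mathbb N$, $[x]_k=\sum_{i=0}^k x_i10^{-i}\in\mathbb Q$. Order on $\mathcal R$: $x\preceq y$ iff $[x]_k\le [y]_k$ for all $k\in\mathbb N$. Every nonempty bounded above (below) subset of $(\mathcal R,\preceq)$ has a supremum (infimum). $x\sim y$ ("no gap") means that there is no $z\in\mathcal R\setminus\{x,y\}$ lying strictly between $x$ and $y$ with respect to $\preceq$; $\sim$ is an equivalence relation. $\mathbb Q$ is regarded as a subset of $\mathcal R$ via long division: $\alpha=q/p$ ($p\in\mathbb N$, $q\in\mathbb Z$) is identified with $\alpha_0.\alpha_1\alpha_2\cdots$, where $\alpha_0=\lfloor q/p\rfloor$, $\beta_0=q-\alpha_0p$, $\alpha_{k+1}=\lfloor 10\beta_k/p\rfloor$, $\beta_{k+1}=10\beta_k-\alpha_{k+1}p$. A Dedekind cut $(A|B)$ is a pair of nonempty subsets $A,B$ of $\mathbb Q$ such that $A\cap B=\emptyset$, $A\cup B=\mathbb Q$; $a<b$ for all $a\in A$, $b\in B$; and $A$ contains no greatest element. *)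

theory Defs
  imports Complex_Main
begin

section \<open>Formal decimals\<close>

text \<open>
  Digit sequences are compared literally: \<open>0.999\<dots>\<close> and \<open>1.000\<dots>\<close> are distinct elements.
  The integer part may be negative, while all later digits count positively, so
  for example \<open>-1.5\<close> stands for \<open>-1 + 5/10\<close>.
\<close>

typedef formal_decimal = "{d :: nat \<Rightarrow> int. \<forall>k\<ge>1. d k \<in> {0..9}}"
  morphisms digit Abs_formal_decimal
  by (rule exI[of _ "\<lambda>_. 0"]) simp

definition truncation :: "formal_decimal \<Rightarrow> nat \<Rightarrow> rat" where
  "truncation x k = (\<Sum>i=0..k. of_int (digit x i) / 10 ^ i)"

text \<open>The integer \<open>10 ^ k * truncation x k\<close>, used only in the proofs below.\<close>

primrec scaled :: "(nat \<Rightarrow> int) \<Rightarrow> nat \<Rightarrow> int" where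
  "scaled d 0 = d 0"
| "scaled d (Suc k) = 10 * scaled d k + d (Suc k)"

lemma digit_bounds: "digit x (Suc k) \<ge> 0" "digit x (Suc k) \<le> 9"
  using digit[of x] by auto

lemma truncation_scaled: "truncation x k = of_int (scaled (digit x) k) / 10 ^ k"
  by (induction k) (simp_all add: truncation_def field_simps)

lemma truncation_le_iff:
  "truncation x k \<le> truncation y k \<longleftrightarrow> scaled (digit x) k \<le> scaled (digit y) k"
  by (simp add: truncation_scaled divide_le_cancel)

lemma scaled_Suc_div: "scaled (digit x) (Suc k) div 10 = scaled (digit x) k"
  using digit_bounds[of x k] by simp

lemma scaled_le_down:
  assumes "scaled (digit x) k \<le> scaled (digit y) k" "j \<le> k"
  shows "scaled (digit x) j \<le> scaled (digit y) j"
  using assms(2,1)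
proof (induction rule: inc_induct)
  case base
  then show ?case .
next
  case (step n)
  then show ?case
    using zdiv_mono1[of "scaled (digit x) (Suc n)" "scaled (digit y) (Suc n)" 10]
    by (simp only: scaled_Suc_div)
qed

lemma scaled_inj:
  assumes "\<And>k. scaled (digit x) k = scaled (digit y) k"
  shows "x = y"
proof -
  have "digit x k = digit y k" for k
    using assms[of k] assms[of "k - 1"] by (cases k) auto
  then show ?thesis
    by (metis digit_inject ext)
qed

instantiation formal_decimal :: linorder
begin

definition less_eq_formal_decimal :: "formal_decimal \<Rightarrow> formal_decimal \<Rightarrow> bool" where
  "x \<le> y \<longleftrightarrow> (\<forall>k\<ge>1. truncation x k \<le> truncation y k)"

definition less_formal_decimal :: "formal_decimal \<Rightarrow> formal_decimal \<Rightarrow> bool" where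
  "(x :: formal_decimal) < y \<longleftrightarrow> x \<le> y \<and> x \<noteq> y"

lemma le_iff_scaled:
  fixes x y :: formal_decimal
  shows "x \<le> y \<longleftrightarrow> (\<forall>k. scaled (digit x) k \<le> scaled (digit y) k)"
  unfolding less_eq_formal_decimal_def truncation_le_iff
  by (meson scaled_le_down le_add2 le_add1)

instance
proof
  fix x y z :: formal_decimal
  show "x = y" if "x \<le> y" "y \<le> x"
    using that by (intro scaled_inj) (auto simp: le_iff_scaled intro: antisym)
  show "x < y \<longleftrightarrow> x \<le> y \<and> \<not> y \<le> x"
    by (metis less_formal_decimal_def le_iff_scaled scaled_inj order_antisym order_refl)
  show "x \<le> x"
    by (simp add: le_iff_scaled)
  show "x \<le> z" if "x \<le> y" "y \<le> z"
    using that by (meson le_iff_scaled order_trans)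
  show "x \<le> y \<or> y \<le> x"
    unfolding le_iff_scaled by (metis linear scaled_le_down)
qed

end

lemma formal_decimal_lub_exists:
  fixes X :: "formal_decimal set"
  assumes "X \<noteq> {}" and ub: "\<And>x. x \<in> X \<Longrightarrow> x \<le> u"
  shows "\<exists>s. (\<forall>x\<in>X. x \<le> s) \<and> (\<forall>v. (\<forall>x\<in>X. x \<le> v) \<longrightarrow> s \<le> v)"
proof -
  have "\<exists>m. (\<exists>x\<in>X. scaled (digit x) k = m) \<and> (\<forall>x\<in>X. scaled (digit x) k \<le> m)" for k
  proof -
    let ?f = "\<lambda>x. nat (scaled (digit u) k - scaled (digit x) k)"
    from \<open>X \<noteq> {}\<close> obtain w where "w \<in> X" by blast
    then obtain y where y: "y \<in> X" "\<And>x. x \<in> X \<Longrightarrow> ?f y \<le> ?f x"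
      using ex_has_least_nat[of "\<lambda>x. x \<in> X" w ?f] by blast
    have "scaled (digit x) k \<le> scaled (digit y) k" if "x \<in> X" for x
      using y(2)[OF that] ub[OF that] ub[OF y(1)] by (force simp: le_iff_scaled nat_le_eq_zle)
    with y(1) show ?thesis by blast
  qed
  then obtain m where m1: "\<And>k. \<exists>x\<in>X. scaled (digit x) k = m k"
    and m2: "\<And>k x. x \<in> X \<Longrightarrow> scaled (digit x) k \<le> m k"
    by metis
  have m_div: "m (Suc k) div 10 = m k" for k
  proof (rule antisym)
    obtain x where "x \<in> X" "scaled (digit x) (Suc k) = m (Suc k)" using m1 by blast
    then show "m (Suc k) div 10 \<le> m k" using m2 scaled_Suc_div by metis
    obtain x where "x \<in> X" "scaled (digit x) k = m k" using m1 by blast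
    then show "m k \<le> m (Suc k) div 10"
      using m2[of x "Suc k"] scaled_Suc_div[of x k] zdiv_mono1[of _ "m (Suc k)" 10] by fastforce
  qed
  define d where "d = (\<lambda>k. case k of 0 \<Rightarrow> m 0 | Suc j \<Rightarrow> m (Suc j) mod 10)"
  define s where "s = Abs_formal_decimal d"
  have "d k \<in> {0..9}" if "k \<ge> 1" for k
  proof -
    from that obtain j where "k = Suc j" by (cases k) auto
    then show ?thesis
      using pos_mod_bound[of 10 "m (Suc j)"] pos_mod_sign[of 10 "m (Suc j)"] by (auto simp: d_def)
  qed
  then have dig: "digit s = d"
    unfolding s_def by (intro Abs_formal_decimal_inverse) auto
  have sc: "scaled (digit s) k = m k" for k
  proof (induction k)
    case 0
    then show ?case by (simp add: dig d_def)
  next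
    case (Suc k)
    then show ?case
      using m_div[of k] mult_div_mod_eq[of 10 "m (Suc k)"] by (simp add: dig d_def)
  qed
  show ?thesis
  proof (intro exI conjI ballI allI impI)
    show "x \<le> s" if "x \<in> X" for x
      using m2[OF that] by (simp add: le_iff_scaled sc)
    show "s \<le> v" if "\<forall>x\<in>X. x \<le> v" for v
      unfolding le_iff_scaled sc using m1 that le_iff_scaled by metis
  qed
qed

lemma formal_decimal_glb_exists:
  fixes X :: "formal_decimal set"
  assumes "X \<noteq> {}" and "\<And>x. x \<in> X \<Longrightarrow> l \<le> x"
  shows "\<exists>i. (\<forall>x\<in>X. i \<le> x) \<and> (\<forall>v. (\<forall>x\<in>X. v \<le> x) \<longrightarrow> v \<le> i)"
proof -
  obtain x0 where "x0 \<in> X" using assms by blast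
  then have "\<exists>s. (\<forall>y\<in>{v. \<forall>x\<in>X. v \<le> x}. y \<le> s) \<and>
      (\<forall>w. (\<forall>y\<in>{v. \<forall>x\<in>X. v \<le> x}. y \<le> w) \<longrightarrow> s \<le> w)"
    using assms by (intro formal_decimal_lub_exists[where u = x0]) auto
  then show ?thesis by blast
qed

instantiation formal_decimal :: conditionally_complete_linorder
begin

definition inf_formal_decimal :: "formal_decimal \<Rightarrow> formal_decimal \<Rightarrow> formal_decimal" where
  "inf_formal_decimal = min"

definition sup_formal_decimal :: "formal_decimal \<Rightarrow> formal_decimal \<Rightarrow> formal_decimal" where
  "sup_formal_decimal = max"

definition Sup_formal_decimal :: "formal_decimal set \<Rightarrow> formal_decimal" where
  "Sup (X :: formal_decimal set) = (LEAST s. \<forall>x\<in>X. x \<le> s)"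

definition Inf_formal_decimal :: "formal_decimal set \<Rightarrow> formal_decimal" where
  "Inf (X :: formal_decimal set) = (GREATEST i. \<forall>x\<in>X. i \<le> x)"

lemma Sup_formal_decimal_props:
  fixes X :: "formal_decimal set"
  assumes "X \<noteq> {}" "\<And>x. x \<in> X \<Longrightarrow> x \<le> u"
  shows "(\<forall>x\<in>X. x \<le> Sup X) \<and> (\<forall>v. (\<forall>x\<in>X. x \<le> v) \<longrightarrow> Sup X \<le> v)"
proof -
  obtain s where s: "\<forall>x\<in>X. x \<le> s" "\<forall>v. (\<forall>x\<in>X. x \<le> v) \<longrightarrow> s \<le> v"
    using formal_decimal_lub_exists[OF assms] by blast
  then have "Sup X = s"
    unfolding Sup_formal_decimal_def by (intro Least_equality) auto
  with s show ?thesis by simp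
qed

lemma Inf_formal_decimal_props:
  fixes X :: "formal_decimal set"
  assumes "X \<noteq> {}" "\<And>x. x \<in> X \<Longrightarrow> l \<le> x"
  shows "(\<forall>x\<in>X. Inf X \<le> x) \<and> (\<forall>v. (\<forall>x\<in>X. v \<le> x) \<longrightarrow> v \<le> Inf X)"
proof -
  obtain i where i: "\<forall>x\<in>X. i \<le> x" "\<forall>v. (\<forall>x\<in>X. v \<le> x) \<longrightarrow> v \<le> i"
    using formal_decimal_glb_exists[OF assms] by blast
  then have "Inf X = i"
    unfolding Inf_formal_decimal_def by (intro Greatest_equality) auto
  with i show ?thesis by simp
qed

instance
proof
  fix x y z :: formal_decimal and X :: "formal_decimal set"
  show "inf x y \<le> x" "inf x y \<le> y" "x \<le> sup x y" "y \<le> sup x y"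
    by (simp_all add: inf_formal_decimal_def sup_formal_decimal_def)
  show "x \<le> inf y z" if "x \<le> y" "x \<le> z"
    using that by (simp add: inf_formal_decimal_def)
  show "sup y z \<le> x" if "y \<le> x" "z \<le> x"
    using that by (simp add: sup_formal_decimal_def)
  show "Inf X \<le> x" if "x \<in> X" "bdd_below X"
    using that Inf_formal_decimal_props[of X] unfolding bdd_below_def by blast
  show "z \<le> Inf X" if "X \<noteq> {}" "\<And>x. x \<in> X \<Longrightarrow> z \<le> x"
    using that Inf_formal_decimal_props[of X z] by blast
  show "x \<le> Sup X" if "x \<in> X" "bdd_above X"
    using that Sup_formal_decimal_props[of X] unfolding bdd_above_def by blast
  show "Sup X \<le> z" if "X \<noteq> {}" "\<And>x. x \<in> X \<Longrightarrow> x \<le> z"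
    using that Sup_formal_decimal_props[of X z] by blast
qed

end

definition no_gap :: "formal_decimal \<Rightarrow> formal_decimal \<Rightarrow> bool"  (infix "\<sim>" 50) where
  "x \<sim> y \<longleftrightarrow> \<not> (\<exists>z. (x < z \<and> z < y) \<or> (y < z \<and> z < x))"


section \<open>Rational numbers as formal decimals\<close>

text \<open>Integer \<open>div\<close> rounds down for \<open>p > 0\<close>, also when \<open>q\<close> is negative.\<close>

primrec long_division_rem :: "int \<Rightarrow> int \<Rightarrow> nat \<Rightarrow> int" where
  "long_division_rem q p 0 = q - (q div p) * p"
| "long_division_rem q p (Suc k) =
     10 * long_division_rem q p k - ((10 * long_division_rem q p k) div p) * p"

primrec long_division_digit :: "int \<Rightarrow> int \<Rightarrow> nat \<Rightarrow> int" where
  "long_division_digit q p 0 = q div p"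
| "long_division_digit q p (Suc k) = (10 * long_division_rem q p k) div p"

definition decimal_of_fraction :: "int \<Rightarrow> int \<Rightarrow> formal_decimal" where
  "decimal_of_fraction q p = Abs_formal_decimal (long_division_digit q p)"

definition decimal_of_rat :: "rat \<Rightarrow> formal_decimal" where
  "decimal_of_rat \<alpha> = (case quotient_of \<alpha> of (q, p) \<Rightarrow> decimal_of_fraction q p)"

lemma long_division_rem_bounds:
  assumes "p > 0"
  shows "0 \<le> long_division_rem q p k" "long_division_rem q p k < p"
  using assms by (cases k; simp add: minus_div_mult_eq_mod)+

lemma digit_decimal_of_fraction:
  assumes "p > 0"
  shows "digit (decimal_of_fraction q p) = long_division_digit q p"
proof -
  have "long_division_digit q p k \<in> {0..9}" if k: "k \<ge> 1" for k
  proof -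
    from k obtain j where [simp]: "k = Suc j" by (cases k) auto
    let ?r = "long_division_rem q p j"
    have "0 \<le> ?r" "?r < p" using long_division_rem_bounds[OF assms] by auto
    have "10 * ?r div p * p \<le> 10 * ?r"
      using assms by (simp add: minus_mod_eq_div_mult [symmetric])
    also have "\<dots> < 10 * p" using \<open>?r < p\<close> by simp
    finally have "10 * ?r div p < 10" using assms by simp
    moreover have "0 \<le> 10 * ?r div p"
      using assms \<open>0 \<le> ?r\<close> by (simp add: pos_imp_zdiv_nonneg_iff)
    ultimately show ?thesis by simp
  qed
  then show ?thesis
    unfolding decimal_of_fraction_def by (intro Abs_formal_decimal_inverse) auto
qed

text \<open>The expansion does not depend on the fraction chosen to represent the rational number.\<close>

lemma scaled_long_division:
  assumes "p > 0"
  shows "scaled (long_division_digit q p) k * p + long_division_rem q p k = 10 ^ k * q"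
  by (induction k) (simp_all add: algebra_simps)

lemma scaled_decimal_of_fraction:
  assumes "p > 0"
  shows "scaled (digit (decimal_of_fraction q p)) k = \<lfloor>10 ^ k * (of_int q / of_int p :: rat)\<rfloor>"
proof -
  let ?s = "scaled (long_division_digit q p) k" and ?r = "long_division_rem q p k"
  have "(10 ^ k * q) div p = (?r + ?s * p) div p"
    using scaled_long_division[OF assms, of q k] by (simp add: add.commute)
  also have "\<dots> = ?s"
    using long_division_rem_bounds[OF assms, of q k] by simp
  finally have "?s = \<lfloor>of_int (10 ^ k * q) / (of_int p :: rat)\<rfloor>"
    by (simp only: floor_divide_of_int_eq)
  then show ?thesis
    by (simp add: digit_decimal_of_fraction[OF assms])
qed

lemma scaled_decimal_of_rat: "scaled (digit (decimal_of_rat a)) k = \<lfloor>10 ^ k * a\<rfloor>"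
proof -
  obtain q p where qp: "quotient_of a = (q, p)" by fastforce
  then have "decimal_of_rat a = decimal_of_fraction q p"
    by (simp add: decimal_of_rat_def)
  then show ?thesis
    using scaled_decimal_of_fraction[OF quotient_of_denom_pos[OF qp], of q k] quotient_of_div[OF qp]
    by simp
qed

lemma decimal_of_rat_divide:
  assumes "p > 0"
  shows "decimal_of_rat (of_int q / of_int p) = decimal_of_fraction q p"
  by (rule scaled_inj) (simp only: scaled_decimal_of_rat scaled_decimal_of_fraction[OF assms])

lemma decimal_of_rat_mono:
  assumes "\<alpha> \<le> \<beta>"
  shows "decimal_of_rat \<alpha> \<le> decimal_of_rat \<beta>"
  using assms by (simp add: le_iff_scaled scaled_decimal_of_rat floor_mono)


section \<open>Dedekind cuts\<close>

definition dedekind_cut :: "rat set \<Rightarrow> rat set \<Rightarrow> bool" where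
  "dedekind_cut A B \<longleftrightarrow>
     A \<noteq> {} \<and> B \<noteq> {} \<and> A \<inter> B = {} \<and> A \<union> B = UNIV \<and>
     (\<forall>a\<in>A. \<forall>b\<in>B. a < b) \<and> \<not> (\<exists>m\<in>A. \<forall>a\<in>A. a \<le> m)"

text \<open>Hence the supremum and the infimum of the two halves of a cut are genuine ones.\<close>

lemma dedekind_cut_bdd:
  assumes "dedekind_cut A B"
  shows "bdd_above (decimal_of_rat ` A)" "bdd_below (decimal_of_rat ` B)"
proof -
  from assms obtain a b where ab: "a \<in> A" "b \<in> B" and lt: "\<And>x y. x \<in> A \<Longrightarrow> y \<in> B \<Longrightarrow> x < y"
    unfolding dedekind_cut_def by blast
  show "bdd_above (decimal_of_rat ` A)"
    using lt[OF _ ab(2)] by (intro bdd_aboveI2[where M = "decimal_of_rat b"] decimal_of_rat_mono less_imp_le)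
  show "bdd_below (decimal_of_rat ` B)"
    using lt[OF ab(1)] by (intro bdd_belowI2[where m = "decimal_of_rat a"] decimal_of_rat_mono less_imp_le)
qed

end

(* If z lay strictly between sup A and inf B, its truncation at some position k would be strictly
   between theirs. The long division expansion of the rational number q = [z]_k agrees with z up
   to position k, so q is neither below sup A nor above inf B and lies in neither half of the cut. *)
theory Submission imports Defs begin

text \<open>A strict inequality at one position \<open>n\<close> persists: \<open>scaled\<close> at
  \<open>n\<close> is an iterated integer quotient by 10 of \<open>scaled\<close> at any later
  \<open>k\<close>, so a reversed comparison at \<open>k\<close> would descend to
  \<open>n\<close>.\<close>

lemma eventually_scaled_less:
  assumes "x < y"
  shows "\<forall>\<^sub>F k in sequentially. scaled (digit x) k < scaled (digit y) k"
proof -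
  from assms have "\<not> y \<le> x"
    by simp
  then obtain n where "scaled (digit x) n < scaled (digit y) n"
    unfolding le_iff_scaled not_all not_le by blast
  then have "scaled (digit x) k < scaled (digit y) k" if "k \<ge> n" for k
    using that scaled_le_down[of y k x n] by linarith
  then show ?thesis
    unfolding eventually_sequentially by blast
qed

text \<open>\<open>10 ^ k * truncation x k\<close> is already an integer, so the floor from long
  division leaves it unchanged.\<close>

lemma scaled_decimal_of_truncation:
  "scaled (digit (decimal_of_rat (truncation x k))) k = scaled (digit x) k"
  by (simp add: scaled_decimal_of_rat truncation_scaled)

lemma dedekind_cut_Sup_le_Inf:
  assumes "dedekind_cut A B"
  shows "Sup (decimal_of_rat ` A) \<le> Inf (decimal_of_rat ` B)"
proof (intro cSup_least cInf_greatest)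
  fix x y
  assume "x \<in> decimal_of_rat ` A" "y \<in> decimal_of_rat ` B"
  then obtain a b where "a \<in> A" "b \<in> B" "x = decimal_of_rat a" "y = decimal_of_rat b"
    by blast
  moreover from this have "a < b"
    using assms unfolding dedekind_cut_def by blast
  ultimately show "x \<le> y"
    by (simp add: decimal_of_rat_mono)
qed (use assms in \<open>simp_all add: dedekind_cut_def\<close>)

theorem theorem6p2:
  fixes A B :: "rat set"
  assumes "dedekind_cut A B"
  shows "Sup (decimal_of_rat ` A) \<sim> Inf (decimal_of_rat ` B)"
proof -
  let ?s = "Sup (decimal_of_rat ` A)" and ?i = "Inf (decimal_of_rat ` B)"
  have False if "?s < z" "z < ?i" for z
  proof -
    \<comment> \<open>The two inequalities may become strict at different positions; the eventual
      form yields a common \<open>k\<close>.\<close>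
    have "\<forall>\<^sub>F k in sequentially. scaled (digit ?s) k < scaled (digit z) k \<and>
        scaled (digit z) k < scaled (digit ?i) k"
      using that by (intro eventually_conj eventually_scaled_less)
    then obtain k where k: "scaled (digit ?s) k < scaled (digit z) k"
        "scaled (digit z) k < scaled (digit ?i) k"
      unfolding eventually_sequentially by blast
    let ?q = "truncation z k"
    \<comment> \<open>Since \<le> compares all positions, failure at position \<open>k\<close> alone
      refutes it.\<close>
    have "\<not> decimal_of_rat ?q \<le> ?s"
      using k(1) unfolding le_iff_scaled
      by (intro notI) (drule spec[of _ k], simp add: scaled_decimal_of_truncation)
    then have "?q \<notin> A"
      using cSup_upper[OF imageI dedekind_cut_bdd(1)[OF assms]] by blast
    have "\<not> ?i \<le> decimal_of_rat ?q"
      using k(2) unfolding le_iff_scaled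
      by (intro notI) (drule spec[of _ k], simp add: scaled_decimal_of_truncation)
    then have "?q \<notin> B"
      using cInf_lower[OF imageI dedekind_cut_bdd(2)[OF assms]] by blast
    with \<open>?q \<notin> A\<close> assms show False
      unfolding dedekind_cut_def by blast
  qed
  \<comment> \<open>\<open>no_gap\<close> is symmetric, so the reverse order of the endpoints must
    be excluded too.\<close>
  moreover have "\<not> (?i < z \<and> z < ?s)" for z
    using dedekind_cut_Sup_le_Inf[OF assms] by auto
  ultimately show ?thesis
    unfolding no_gap_def by blast
qed

end
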